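(* Let $a$ be a complex number which is not a non-positive integer, and let $n,\lambda\in\mathbb Z_{\ge0}$. Put \[ B_{n,\lambda}(z)=\sum_{i=0}^n\binom ni\frac{(-1)^i z^{n-i}}{(a)_{i+\lambda}} . \] Then $\deg_z B_{n,\lambda}=n$, and there is a polynomial $A_{n,\lambda}(z)$ with $\deg_z A_{n,\lambda}\le n+\lambda-1$ such that, as formal power series in $z$, \[ B_{n,\lambda}(z)\,{}_2F_0(a,1\mid z)-A_{n,\lambda}(z)=L_{n,\lambda}(z), \] where $\operatorname{ord}_{z=0}L_{n,\lambda}(z)=2n+\lambda$ and explicitly \[ L_{n,\lambda}(z)=(-1)^n n!\,z^{2n+\lambda}\sum_{k=0}^\infty k!\binom{n+k}{k}\binom{n+k+a+\lambda-1}{k}z^k . \]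
   Context: The Pochhammer symbol is defined by $(a)_0=1$ and $(a)_{k+1}=(a+k)(a)_k$ for $k\in\mathbb Z_{\ge0}$. The formal hypergeometric series is ${}_2F_0(a,1\mid z)=\sum_{k=0}^\infty (a)_k z^k$. For non-integer upper entry, $\binom{x}{k}=x(x-1)\cdots(x-k+1)/k!$, so that $\binom{n+k+a+\lambda-1}{k}=(n+a+\lambda)_k/k!$. $\operatorname{ord}_{z=0}$ of a formal power series is the smallest exponent with a nonzero coefficient. *)

theory Defs
  imports
    Complex_Main
    "HOL-Computational_Algebra.Computational_Algebra"
    "HOL-Library.Nonpos_Ints"
begin

text \<open>In \<open>2F0(a,1|z)\<close> the factor \<open>(1)\<^sub>k\<close> cancels the \<open>k!\<close> in the denominator.\<close>

definition hyp2F0_1 :: "complex \<Rightarrow> complex fps" where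
  "hyp2F0_1 a = Abs_fps (\<lambda>k. pochhammer a k)"

lemma hyp2F0_1_eq_fps_hypergeo: "hyp2F0_1 a = fps_hypergeo [a, 1] [] 1"
  by (simp add: hyp2F0_1_def fps_eq_iff pochhammer_fact [symmetric])

definition B_poly :: "complex \<Rightarrow> nat \<Rightarrow> nat \<Rightarrow> complex poly" where
  "B_poly a n l =
     (\<Sum>i=0..n. monom (of_nat (n choose i) * (-1) ^ i / pochhammer a (i + l)) (n - i))"

definition L_fps :: "complex \<Rightarrow> nat \<Rightarrow> nat \<Rightarrow> complex fps" where
  "L_fps a n l =
     fps_const ((-1) ^ n * fact n) * fps_X ^ (2 * n + l) *
     Abs_fps (\<lambda>k. fact k * of_nat ((n + k) choose k) *
                   ((of_nat n + of_nat k + a + of_nat l - 1) gchoose k))"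

end

theory Submission
  imports Defs
begin

text \<open>
  Every coefficient of \<open>B\<^bsub>n,\<lambda>\<^esub> \<cdot> \<^sub>2F\<^sub>0\<close> of index \<open>m \<ge> n + \<lambda>\<close> is an \<open>n\<close>-th finite difference:
  with \<open>m = n + \<lambda> + s\<close>, the quotient \<open>(a)\<^bsub>\<lambda>+s+i\<^esub> / (a)\<^bsub>\<lambda>+i\<^esub>\<close> is the value at \<open>a + \<lambda> + i\<close> of the
  degree \<open>s\<close> polynomial \<open>(x)\<^sub>s\<close>. Since the forward difference of \<open>(x)\<^sub>s\<close> is \<open>s (x+1)\<^bsub>s-1\<^esub>\<close>, the
  coefficient vanishes for \<open>s < n\<close> and has the stated closed form otherwise. The polynomial \<open>A\<close> is
  the truncation of the product below degree \<open>n + \<lambda>\<close>.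
\<close>

text \<open>Pascal's rule, followed by a shift of index: one order of differencing moves from the
  binomial weights onto \<open>f\<close>. This drives the induction on \<open>n\<close>.\<close>

lemma alternating_binomial_sum_Suc:
  fixes f :: "nat \<Rightarrow> 'a::comm_ring_1"
  shows "(\<Sum>i\<le>Suc n. of_nat (Suc n choose i) * (-1) ^ i * f i) =
         (\<Sum>i\<le>n. of_nat (n choose i) * (-1) ^ i * (f i - f (Suc i)))"
proof -
  have "(\<Sum>i\<le>Suc n. of_nat (Suc n choose i) * (-1) ^ i * f i) =
        f 0 + (\<Sum>i\<le>n. of_nat (n choose Suc i) * (-1) ^ Suc i * f (Suc i))
            - (\<Sum>i\<le>n. of_nat (n choose i) * (-1) ^ i * f (Suc i))"
    by (simp add: sum.atMost_Suc_shift algebra_simps sum.distrib sum_negf sum_subtractf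
             del: sum.atMost_Suc)
  \<comment> \<open>The upper limit \<open>Suc n\<close> adds only a term with
    \<open>n choose Suc n = 0\<close>.\<close>
  also have "f 0 + (\<Sum>i\<le>n. of_nat (n choose Suc i) * (-1) ^ Suc i * f (Suc i)) =
             (\<Sum>i\<le>Suc n. of_nat (n choose i) * (-1) ^ i * f i)"
    by (simp add: sum.atMost_Suc_shift del: sum.atMost_Suc)
  finally show ?thesis
    by (simp add: binomial_eq_0 right_diff_distrib sum_subtractf)
qed

text \<open>For \<open>s > 0\<close> both symbols share the factor
  \<open>pochhammer (x + 1) (s - 1)\<close>, with cofactors \<open>x\<close> and
  \<open>x + s\<close>. For \<open>s = 0\<close> the factor \<open>of_nat s\<close> makes the
  truncated \<open>s - 1\<close> harmless.\<close>

lemma pochhammer_forward_difference: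
  fixes x :: "'a::comm_ring_1"
  shows "pochhammer x s - pochhammer (x + 1) s = - (of_nat s * pochhammer (x + 1) (s - 1))"
proof (cases s)
  case (Suc t)
  then show ?thesis
    by (simp add: pochhammer_rec[of x t] pochhammer_Suc[of "x + 1" t])
       (simp add: algebra_simps)
qed simp

text \<open>Each difference lowers \<open>s\<close> by one and shifts \<open>x\<close> by one; the
  collected factors \<open>s (s-1) ... (s-n+1)\<close> are \<open>fact n * (s choose n)\<close>.
  This is 0 for \<open>s < n\<close>, where \<open>s - n\<close> truncates.\<close>

lemma alternating_binomial_sum_pochhammer:
  fixes x :: "'a::comm_ring_1"
  shows "(\<Sum>i\<le>n. of_nat (n choose i) * (-1) ^ i * pochhammer (x + of_nat i) s) =
         (-1) ^ n * of_nat (fact n * (s choose n)) * pochhammer (x + of_nat n) (s - n)"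
proof (induction n arbitrary: x s)
  case (Suc n)
  have diff: "pochhammer (x + of_nat i) s - pochhammer (x + of_nat (Suc i)) s =
        - of_nat s * pochhammer (x + 1 + of_nat i) (s - 1)" for i
    using pochhammer_forward_difference[of "x + of_nat i" s] by (simp add: add_ac)
  have absorb: "s * (fact n * (s - 1 choose n)) = fact (Suc n) * (s choose Suc n)"
  proof (cases s)
    case (Suc t)
    show ?thesis
      using Suc_times_binomial_eq[of t n] unfolding Suc
      by (simp del: binomial_Suc_Suc mult_Suc mult_Suc_right add: fact_Suc mult_ac)
  qed simp
  have "(\<Sum>i\<le>Suc n. of_nat (Suc n choose i) * (-1) ^ i * pochhammer (x + of_nat i) s) =
        - of_nat s *
        (\<Sum>i\<le>n. of_nat (n choose i) * (-1) ^ i * pochhammer (x + 1 + of_nat i) (s - 1))"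
    unfolding alternating_binomial_sum_Suc diff by (simp add: sum_distrib_left mult_ac)
  also have "\<dots> = (-1) ^ Suc n * of_nat (s * (fact n * (s - 1 choose n))) *
                   pochhammer (x + of_nat (Suc n)) (s - Suc n)"
    unfolding Suc.IH by (simp add: algebra_simps)
  finally show ?case
    unfolding absorb .
qed simp

lemma pochhammer_neq_0_of_not_nonpos_Int:
  fixes a :: "'a::field_char_0"
  assumes "a \<notin> \<int>\<^sub>\<le>\<^sub>0"
  shows "pochhammer a k \<noteq> 0"
  using assms by (auto simp: pochhammer_eq_0_iff)

lemma coeff_B_poly:
  "coeff (B_poly a n l) n = 1 / pochhammer a l"
proof -
  have "coeff (B_poly a n l) n =
        (\<Sum>i=0..n. if i = 0 then 1 / pochhammer a l else 0)"
    unfolding B_poly_def coeff_sum by (intro sum.cong) auto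
  then show ?thesis
    by simp
qed

lemma degree_B_poly_le: "degree (B_poly a n l) \<le> n"
  unfolding B_poly_def
  by (intro degree_sum_le) (auto intro: order.trans[OF degree_monom_le])

lemma fps_nth_B_poly_mult_hyp2F0_1:
  assumes "a \<notin> \<int>\<^sub>\<le>\<^sub>0"
  shows "(fps_of_poly (B_poly a n l) * hyp2F0_1 a) $ (n + l + s) =
         (-1) ^ n * of_nat (fact n * (s choose n)) *
         pochhammer (a + of_nat l + of_nat n) (s - n)"
proof -
  have "(fps_of_poly (B_poly a n l) * hyp2F0_1 a) $ (n + l + s) =
        (\<Sum>i\<le>n. of_nat (n choose i) * (-1) ^ i / pochhammer a (i + l) *
                pochhammer a (n + l + s - (n - i)))"
    by (simp add: B_poly_def hyp2F0_1_def fps_of_poly_sum fps_of_poly_monom sum_distrib_right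
          fps_sum_nth mult.assoc fps_X_power_mult_nth atMost_atLeast0)
       (intro sum.cong; auto)
  also have "\<dots> = (\<Sum>i\<le>n. of_nat (n choose i) * (-1) ^ i * pochhammer (a + of_nat l + of_nat i) s)"
  proof (intro sum.cong refl)
    fix i assume "i \<in> {..n}"
    \<comment> \<open>Since \<open>i \<le> n\<close>, no subtraction truncates, and
      \<open>pochhammer a (i + l)\<close> splits off and cancels the nonzero denominator.\<close>
    then have "n + l + s - (n - i) = (i + l) + s"
      by simp
    then show "of_nat (n choose i) * (-1) ^ i / pochhammer a (i + l) *
                 pochhammer a (n + l + s - (n - i)) =
               of_nat (n choose i) * (-1) ^ i * pochhammer (a + of_nat l + of_nat i) s"
      using pochhammer_neq_0_of_not_nonpos_Int[OF assms, of "i + l"]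
      by (simp add: pochhammer_product' add_ac)
  qed
  finally show ?thesis
    unfolding alternating_binomial_sum_pochhammer .
qed

text \<open>Puts \<open>L_fps\<close> into the shape of the finite-difference formula, so that
  coefficients can be compared directly.\<close>

lemma fps_nth_L_fps:
  "L_fps a n l $ m =
     (if m < 2 * n + l then 0
      else (-1) ^ n * of_nat (fact n * (m - (n + l) choose n)) *
           pochhammer (a + of_nat l + of_nat n) (m - (2 * n + l)))"
proof (cases "m < 2 * n + l")
  case False
  define k where "k = m - (2 * n + l)"
  have m: "m = 2 * n + l + k"
    using False by (simp add: k_def)
  \<comment> \<open>The falling product from \<open>n + k + a + l - 1\<close> has lowest factor
    \<open>a + l + n\<close>.\<close>
  have "fact k * ((of_nat n + of_nat k + a + of_nat l - 1) gchoose k) =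
        pochhammer (a + of_nat l + of_nat n) k"
    by (simp add: gbinomial_pochhammer' algebra_simps)
  moreover have "n + k choose k = n + k choose n"
    using binomial_symmetric[of k "n + k"] by simp
  ultimately show ?thesis
    by (simp add: m L_fps_def mult.assoc fps_X_power_mult_nth mult_ac)
qed (simp add: L_fps_def mult.assoc fps_X_power_mult_nth)

text \<open>The lowest coefficient is \<open>(-1) ^ n * fact n\<close>.\<close>

lemma subdegree_L_fps: "L_fps a n l \<noteq> 0" "subdegree (L_fps a n l) = 2 * n + l"
proof -
  have nz: "L_fps a n l $ (2 * n + l) \<noteq> 0"
    by (simp add: fps_nth_L_fps)
  then show "L_fps a n l \<noteq> 0"
    by auto
  show "subdegree (L_fps a n l) = 2 * n + l"
    using nz by (intro subdegreeI) (simp_all add: fps_nth_L_fps)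
qed

text \<open>For \<open>n = l = 0\<close> the degree bound is -1, which forces \<open>A = 0\<close>;
  hence the disjunction and the integer arithmetic.\<close>

theorem theorem2:
  fixes a :: complex and n l :: nat
  assumes "a \<notin> \<int>\<^sub>\<le>\<^sub>0"
  shows "B_poly a n l \<noteq> 0 \<and> degree (B_poly a n l) = n \<and>
    (\<exists>A :: complex poly.
       (A = 0 \<or> int (degree A) \<le> int n + int l - 1) \<and>
       fps_of_poly (B_poly a n l) * hyp2F0_1 a - fps_of_poly A = L_fps a n l) \<and>
    L_fps a n l \<noteq> 0 \<and> subdegree (L_fps a n l) = 2 * n + l"
proof -
  have lead: "coeff (B_poly a n l) n \<noteq> 0"
    using pochhammer_neq_0_of_not_nonpos_Int[OF assms] by (simp add: coeff_B_poly)
  then have "B_poly a n l \<noteq> 0"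
    by auto
  moreover have "degree (B_poly a n l) = n"
    using lead degree_B_poly_le le_degree by (blast intro: antisym)
  moreover have "\<exists>A :: complex poly.
       (A = 0 \<or> int (degree A) \<le> int n + int l - 1) \<and>
       fps_of_poly (B_poly a n l) * hyp2F0_1 a - fps_of_poly A = L_fps a n l"
  proof -
    define P where "P = fps_of_poly (B_poly a n l) * hyp2F0_1 a"
    define A where "A = (\<Sum>i<n + l. monom (P $ i) i)"
    have coeff_A: "coeff A m = (if m < n + l then P $ m else 0)" for m
      by (simp add: A_def coeff_sum)
    have "int (degree A) \<le> int n + int l - 1" if "A \<noteq> 0"
    proof -
      from that have "coeff A (degree A) \<noteq> 0"
        by simp
      then have "degree A < n + l"
        unfolding coeff_A by (auto split: if_splits)
      then show ?thesis
        by linarith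
    qed
    moreover have "(P - fps_of_poly A) $ m = L_fps a n l $ m" for m
    proof (cases "m < n + l")
      case True
      then show ?thesis
        by (simp add: coeff_A fps_nth_L_fps)
    next
      case False
      then have "(P - fps_of_poly A) $ m = P $ (n + l + (m - (n + l)))"
        by (simp add: coeff_A)
      also have "\<dots> = L_fps a n l $ m"
        unfolding P_def fps_nth_B_poly_mult_hyp2F0_1[OF assms] fps_nth_L_fps
        \<comment> \<open>In the gap \<open>n + l \<le> m < 2 * n + l\<close> the binomial
          coefficient vanishes.\<close>
        using False by (auto simp: binomial_eq_0 mult_2 add_ac)
      finally show ?thesis .
    qed
    ultimately show ?thesis
      unfolding P_def by (intro exI[of _ A]) (auto simp: fps_eq_iff)
  qed
  ultimately show ?thesis
    using subdegree_L_fps by blast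
qed

end
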